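(* Let $n\in\mathbb N$ and let $A$ be a real $n\times n$ matrix that is diagonalizable over $\mathbb R$ with positive eigenvalues. Let $H:\mathbb R^n\to\mathbb R$ be positively homogeneous of degree $\alpha>0$, have property (HC) on the unit sphere $\{x\in\mathbb R^n:|x|=1\}$, and satisfy $H(x)>0$ for all $|x|=1$. Let $t_*\ge 0$ and let $G:[t_*,\infty)\times\mathbb R^n\to\mathbb R^n$ be continuous, and suppose there are numbers $T_*\ge t_*$ and $c_*,r_*,\delta>0$ such that $|G(t,x)|\le c_*|x|^{1+\alpha+\delta}$ for all $t\ge T_*$ and all $x\in\mathbb R^n$ with $|x|\le r_*$. Let $T\ge t_*$ and let $y\in C^1([T,\infty),\mathbb R^n)$ be a solution of $$y'=-H(y)Ay+G(t,y)\quad\text{on }(T,\infty).$$ Suppose there exist a number $p>0$ and a vector $\xi\in\mathbb R^n\setminus\{0\}$ such that, as $t\to\infty$, $$|y(t)-\xi t^{-p}|=\mathcal O(t^{-p-\varepsilon})\quad\text{for some }\varepsilon>0.$$ Then $p=1/\alpha$ and $\xi$ satisfies $$H(\xi)A\xi=\frac1\alpha\,\xi.$$ Consequently, $\xi$ is an eigenvector of $A$ associated with the eigenvalue $\Lambda=1/(\alpha H(\xi))$.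
   Context: $|\cdot|$ is the Euclidean norm on $\mathbb R^n$. For nonnegative functions $f,g$ defined for large $t$, $f(t)=\mathcal O(g(t))$ as $t\to\infty$ means there are $T'$ and $C>0$ with $f(t)\le Cg(t)$ for all $t\ge T'$. A function $F:\mathbb R^n\to\mathbb R$ is positively homogeneous of degree $\beta>0$ if $F(tx)=t^\beta F(x)$ for all $x\in\mathbb R^n$ and $t>0$. Property (HC): for a nonempty set $E\subset\mathbb R^n$, a function $F:E\to\mathbb R$ (or the restriction to $E$ of a function on a larger set) has property (HC) on $E$ if for every $x_0\in E$ there exist $r,C,\gamma>0$ (which may depend on $x_0$) such that $|F(x)-F(x_0)|\le C|x-x_0|^\gamma$ for all $x\in E$ with $|x-x_0|<r$. *)

theory Defs
  imports "HOL-Analysis.Analysis" "HOL-Library.Landau_Symbols"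
begin

definition pos_homogeneous :: "real \<Rightarrow> (real ^ 'n \<Rightarrow> real) \<Rightarrow> bool" where
  "pos_homogeneous \<beta> F \<longleftrightarrow> (\<forall>x t. t > 0 \<longrightarrow> F (t *\<^sub>R x) = t powr \<beta> * F x)"

text \<open>Property (HC): pointwise Hoelder continuity, with constants that may depend on the point.\<close>

definition HC_on :: "(real ^ 'n) set \<Rightarrow> (real ^ 'n \<Rightarrow> real) \<Rightarrow> bool" where
  "HC_on E F \<longleftrightarrow>
     (\<forall>x0\<in>E. \<exists>r C \<gamma>. r > 0 \<and> C > 0 \<and> \<gamma> > 0 \<and>
        (\<forall>x\<in>E. norm (x - x0) < r \<longrightarrow> \<bar>F x - F x0\<bar> \<le> C * norm (x - x0) powr \<gamma>))"

definition eigenvector_of :: "real ^ 'n ^ 'n \<Rightarrow> real \<Rightarrow> real ^ 'n \<Rightarrow> bool" where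
  "eigenvector_of A \<mu> v \<longleftrightarrow> v \<noteq> 0 \<and> A *v v = \<mu> *\<^sub>R v"

definition eigenvalue_of :: "real ^ 'n ^ 'n \<Rightarrow> real \<Rightarrow> bool" where
  "eigenvalue_of A \<mu> \<longleftrightarrow> (\<exists>v. eigenvector_of A \<mu> v)"

definition diagonal_matrix :: "real ^ 'n ^ 'n \<Rightarrow> bool" where
  "diagonal_matrix D \<longleftrightarrow> (\<forall>i j. i \<noteq> j \<longrightarrow> D $ i $ j = 0)"

definition diagonalizable_over_reals :: "real ^ 'n ^ 'n \<Rightarrow> bool" where
  "diagonalizable_over_reals A \<longleftrightarrow>
     (\<exists>(S :: real ^ 'n ^ 'n) D. invertible S \<and> diagonal_matrix D \<and> A = S ** D ** matrix_inv S)"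

text \<open>Unlike \<open>C1_differentiable_on\<close>, the derivative is taken relative to the set, so that it is
  one-sided at an endpoint and values of the function outside the set do not matter.\<close>

definition C1_within :: "real set \<Rightarrow> (real \<Rightarrow> real ^ 'n) \<Rightarrow> bool" where
  "C1_within S y \<longleftrightarrow>
     (\<exists>y'. (\<forall>t\<in>S. (y has_vector_derivative y' t) (at t within S)) \<and> continuous_on S y')"

end

theory Submission
  imports Defs "HOL-Real_Asymp.Real_Asymp"
begin

text \<open>Put \<open>z t = t powr p *\<^sub>R y t\<close>, which tends to \<open>\<xi>\<close>, and \<open>w = H \<xi> *\<^sub>R (A *v \<xi>)\<close>, which is nonzero
  because \<open>0\<close> is not an eigenvalue of \<open>A\<close>. By homogeneity and continuity of \<open>H\<close> off the origin,
  \<open>t powr (p * (1 + \<alpha>)) *\<^sub>R y' t\<close> tends to \<open>-w\<close>, so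
  \<open>t *\<^sub>R z' t = p *\<^sub>R z t + t powr (1 - p * \<alpha>) *\<^sub>R (-w + o(1))\<close>.
  A convergent function cannot have \<open>t * f' t\<close> bounded away from \<open>0\<close>, since it would then drift
  logarithmically. This excludes \<open>p * \<alpha> < 1\<close> (test against \<open>w\<close>) and \<open>p * \<alpha> > 1\<close> (test against \<open>\<xi>\<close>),
  and for \<open>p * \<alpha> = 1\<close> it forces \<open>p *\<^sub>R \<xi> = w\<close>.\<close>

section \<open>Continuity of a homogeneous function away from the origin\<close>

lemma HC_on_imp_continuous_on:
  assumes "HC_on E F"
  shows "continuous_on E F"
  unfolding continuous_on_def
proof
  fix x0 assume "x0 \<in> E"
  then obtain r C \<gamma> where *: "r > 0" "C > 0" "\<gamma> > 0"
    "\<And>x. x \<in> E \<Longrightarrow> norm (x - x0) < r \<Longrightarrow> \<bar>F x - F x0\<bar> \<le> C * norm (x - x0) powr \<gamma>"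
    using assms unfolding HC_on_def by meson
  have ev: "\<forall>\<^sub>F x in at x0 within E. norm (F x - F x0) \<le> C * norm (x - x0) powr \<gamma>"
    unfolding eventually_at using * by (intro exI[of _ r]) (auto simp: dist_norm)
  have "((\<lambda>x. norm (x - x0)) \<longlongrightarrow> norm (x0 - x0)) (at x0 within E)"
    by (intro tendsto_intros)
  \<comment> \<open>The base tends to 0, where \<open>powr\<close> with a fixed exponent is
    continuous only for a positive exponent and from nonnegative bases; hence
    \<open>tendsto_powr'\<close> and the appeal to \<open>\<gamma> > 0\<close>.\<close>
  then have "((\<lambda>x. norm (x - x0) powr \<gamma>) \<longlongrightarrow> 0 powr \<gamma>) (at x0 within E)"
    using \<open>\<gamma> > 0\<close> by (intro tendsto_powr') auto
  from tendsto_mult_left[OF this, of C]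
  have "((\<lambda>x. C * norm (x - x0) powr \<gamma>) \<longlongrightarrow> 0) (at x0 within E)" by simp
  with ev show "(F \<longlongrightarrow> F x0) (at x0 within E)"
    by (rule LIM_zero_cancel[OF Lim_null_comparison])
qed

lemma pos_homogeneous_eq_sphere:
  assumes "pos_homogeneous \<beta> F" "x \<noteq> 0"
  shows "F x = norm x powr \<beta> * F (x /\<^sub>R norm x)"
proof -
  have "F (norm x *\<^sub>R (x /\<^sub>R norm x)) = norm x powr \<beta> * F (x /\<^sub>R norm x)"
    using assms unfolding pos_homogeneous_def by (meson zero_less_norm_iff)
  with assms(2) show ?thesis by simp
qed

text \<open>Polar coordinates write \<open>F\<close> as a radial power times \<open>F\<close>
  composed with the projection to the sphere, and both factors are continuous where that projection
  is defined.\<close>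

lemma pos_homogeneous_continuous_on:
  assumes "pos_homogeneous \<beta> F" "continuous_on (sphere 0 1) F"
  shows "continuous_on (- {0}) F"
proof -
  have "continuous_on (- {0}) (\<lambda>x. norm x powr \<beta> * F (x /\<^sub>R norm x))"
    by (intro continuous_intros continuous_on_compose2[OF assms(2)]) (auto simp: field_simps split: if_splits)
  then show ?thesis
    by (rule continuous_on_eq)
       (simp flip: pos_homogeneous_eq_sphere[OF assms(1)])
qed

text \<open>The derivative of \<open>f t + c * ln t\<close> is \<open>f' t + c / t\<close>, which is
  eventually nonpositive, so this function is bounded above; but it tends to infinity because
  \<open>f\<close> converges.\<close>

lemma convergent_log_derivative_not_negative:
  fixes f :: "real \<Rightarrow> real"
  assumes lim: "(f \<longlongrightarrow> L) at_top" and "c > 0"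
    and deriv: "\<forall>\<^sub>F t in at_top. (f has_real_derivative f' t) (at t)"
    and neg: "\<forall>\<^sub>F t in at_top. t * f' t \<le> - c"
  shows False
proof -
  have "\<forall>\<^sub>F t in at_top. (f has_real_derivative f' t) (at t) \<and> t * f' t \<le> - c \<and> t > 0"
    using deriv neg eventually_gt_at_top[of 0] by eventually_elim auto
  then obtain a where a: "\<And>t. t \<ge> a \<Longrightarrow> (f has_real_derivative f' t) (at t)"
     "\<And>t. t \<ge> a \<Longrightarrow> t * f' t \<le> - c" "\<And>t. t \<ge> a \<Longrightarrow> t > 0"
    unfolding eventually_at_top_linorder by auto
  have "f t + c * ln t \<le> f a + c * ln a" if "t \<ge> a" for t
  proof (rule DERIV_nonpos_imp_nonincreasing[OF that])
    fix s assume s: "a \<le> s" "s \<le> t"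
    have "((\<lambda>t. f t + c * ln t) has_real_derivative (f' s + c / s)) (at s)"
      using a(1,3)[OF s(1)] by (auto intro!: derivative_eq_intros)
    moreover have "f' s + c / s \<le> 0"
      using a(2,3)[OF s(1)] by (simp add: field_simps)
    ultimately show "\<exists>y. ((\<lambda>t. f t + c * ln t) has_real_derivative y) (at s) \<and> y \<le> 0" by blast
  qed
  then have "\<forall>\<^sub>F t in at_top. f t + c * ln t \<le> f a + c * ln a"
    unfolding eventually_at_top_linorder by blast
  moreover have "filterlim (\<lambda>t. f t + c * ln t) at_top at_top"
  proof (rule filterlim_tendsto_add_at_top[OF lim])
    show "filterlim (\<lambda>t. c * ln t) at_top at_top" using \<open>c > 0\<close> by real_asymp
  qed
  then have "\<forall>\<^sub>F t in at_top. f t + c * ln t > f a + c * ln a"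
    by (simp add: filterlim_at_top_dense)
  ultimately have "\<forall>\<^sub>F t :: real in at_top. False"
    by eventually_elim simp
  then show False by simp
qed

text \<open>The weight \<open>t powr (- s)\<close> normalizes \<open>t *\<^sub>R z' t\<close> when
  it may grow like \<open>t powr s\<close>. The weight is at most 1 for \<open>t \<ge> 1\<close>, so
  removing it only enlarges a positive component along \<open>v\<close>; that component would then
  stay above \<open>(v \<bullet> v) / 2\<close>, a logarithmic drift of \<open>z\<close> in the
  direction \<open>v\<close>.\<close>

lemma convergent_scaled_log_derivative_limit:
  fixes z :: "real \<Rightarrow> 'a :: real_inner"
  assumes lim: "(z \<longlongrightarrow> l) at_top" and "s \<ge> 0"
    and deriv: "\<forall>\<^sub>F t in at_top. (z has_vector_derivative z' t) (at t)"
    and lim': "((\<lambda>t. t powr (- s) *\<^sub>R t *\<^sub>R z' t) \<longlongrightarrow> v) at_top"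
  shows "v = 0"
proof (rule ccontr)
  assume "v \<noteq> 0"
  have lim_f: "((\<lambda>t. - (v \<bullet> z t)) \<longlongrightarrow> - (v \<bullet> l)) at_top"
    by (intro tendsto_intros lim)
  have deriv_f: "\<forall>\<^sub>F t in at_top. ((\<lambda>t. - (v \<bullet> z t)) has_real_derivative - (v \<bullet> z' t)) (at t)"
    using deriv
  proof eventually_elim
    case (elim t)
    have "((\<lambda>t. v \<bullet> z t) has_vector_derivative v \<bullet> z' t) (at t)"
      by (rule bounded_linear.has_vector_derivative[OF bounded_linear_inner_right elim])
    then show ?case
      unfolding has_real_derivative_iff_has_vector_derivative
      by (rule has_vector_derivative_minus)
  qed
  have "((\<lambda>t. v \<bullet> (t powr (- s) *\<^sub>R t *\<^sub>R z' t)) \<longlongrightarrow> v \<bullet> v) at_top"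
    by (intro tendsto_intros lim')
  then have "\<forall>\<^sub>F t in at_top. v \<bullet> (t powr (- s) *\<^sub>R t *\<^sub>R z' t) > (v \<bullet> v) / 2"
    by (rule order_tendstoD) (use \<open>v \<noteq> 0\<close> in simp)
  then have "\<forall>\<^sub>F t in at_top. t * - (v \<bullet> z' t) \<le> - ((v \<bullet> v) / 2)"
    using eventually_ge_at_top[of 1]
  proof eventually_elim
    case (elim t)
    have le: "t powr (- s) \<le> 1"
      using elim(2) \<open>s \<ge> 0\<close> powr_mono[of "- s" 0 t] by simp
    have gt: "t powr (- s) * (t * (v \<bullet> z' t)) > (v \<bullet> v) / 2" using elim(1) by simp
    \<comment> \<open>The sign is settled first, since dropping a factor at most 1 increases only a
      nonnegative quantity.\<close>
    then have "t powr (- s) * (t * (v \<bullet> z' t)) > 0"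
      using inner_ge_zero[of v] by linarith
    then have "t * (v \<bullet> z' t) > 0"
      using elim(2) by (simp add: zero_less_mult_iff)
    then have "t powr (- s) * (t * (v \<bullet> z' t)) \<le> t * (v \<bullet> z' t)"
      using le mult_right_mono[of "t powr (- s)" 1 "t * (v \<bullet> z' t)"] by simp
    with gt show ?case by simp
  qed
  from convergent_log_derivative_not_negative[OF lim_f _ deriv_f this] show False
    using \<open>v \<noteq> 0\<close> by simp
qed

text \<open>Multiplication by \<open>t powr p\<close> turns the error bound into order
  \<open>t powr (- \<epsilon>)\<close>.\<close>

lemma tendsto_rescale_of_bigo:
  fixes y :: "real \<Rightarrow> 'a :: real_normed_vector"
  assumes "\<epsilon> > 0" "(\<lambda>t. norm (y t - t powr (- p) *\<^sub>R \<xi>)) \<in> O(\<lambda>t. t powr (- p - \<epsilon>))"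
  shows "((\<lambda>t. t powr p *\<^sub>R y t) \<longlongrightarrow> \<xi>) at_top"
proof -
  obtain C where C: "\<forall>\<^sub>F t in at_top. norm (norm (y t - t powr (- p) *\<^sub>R \<xi>)) \<le> C * norm (t powr (- p - \<epsilon>))"
    using assms(2) by (elim landau_o.bigE)
  have "\<forall>\<^sub>F t in at_top. norm (t powr p *\<^sub>R y t - \<xi>) \<le> C * t powr (- \<epsilon>)"
    using C eventually_gt_at_top[of 0]
  proof eventually_elim
    case (elim t)
    have "t powr p *\<^sub>R y t - \<xi> = t powr p *\<^sub>R (y t - t powr (- p) *\<^sub>R \<xi>)"
      using elim(2) by (simp add: scaleR_diff_right flip: powr_add)
    then have "norm (t powr p *\<^sub>R y t - \<xi>) = t powr p * norm (y t - t powr (- p) *\<^sub>R \<xi>)" by simp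
    also have "\<dots> \<le> t powr p * (C * t powr (- p - \<epsilon>))"
      using elim(1) by (intro mult_left_mono) auto
    also have "\<dots> = C * (t powr p * t powr (- p - \<epsilon>))" by simp
    also have "t powr p * t powr (- p - \<epsilon>) = t powr (- \<epsilon>)" by (simp flip: powr_add)
    finally show ?case .
  qed
  moreover have "((\<lambda>t. C * t powr (- \<epsilon>)) \<longlongrightarrow> 0) at_top"
    using \<open>\<epsilon> > 0\<close> by real_asymp
  ultimately show ?thesis
    by (rule LIM_zero_cancel[OF Lim_null_comparison])
qed

theorem theorem5p4:
  fixes A :: "real ^ 'n ^ 'n"
    and H :: "real ^ 'n \<Rightarrow> real"
    and G :: "real \<Rightarrow> real ^ 'n \<Rightarrow> real ^ 'n"
    and y :: "real \<Rightarrow> real ^ 'n"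
    and \<alpha> t_star T_star c_star r_star \<delta> T p :: real
    and \<xi> :: "real ^ 'n"
  assumes A_diag: "diagonalizable_over_reals A"
    and A_pos: "\<And>\<mu>. eigenvalue_of A \<mu> \<Longrightarrow> \<mu> > 0"
    and alpha_pos: "\<alpha> > 0"
    and H_hom: "pos_homogeneous \<alpha> H"
    and H_HC: "HC_on (sphere 0 1) H"
    and H_pos: "\<And>x. norm x = 1 \<Longrightarrow> H x > 0"
    and t_star: "t_star \<ge> 0"
    and G_cont: "continuous_on ({t_star..} \<times> UNIV) (\<lambda>(t, x). G t x)"
    and G_consts: "T_star \<ge> t_star" "c_star > 0" "r_star > 0" "\<delta> > 0"
    and G_bound: "\<And>t x. t \<ge> T_star \<Longrightarrow> norm x \<le> r_star \<Longrightarrow>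
                     norm (G t x) \<le> c_star * norm x powr (1 + \<alpha> + \<delta>)"
    and T: "T \<ge> t_star"
    and y_C1: "C1_within {T..} y"
    and y_ode: "\<And>t. t > T \<Longrightarrow>
                  (y has_vector_derivative (- (H (y t) *\<^sub>R (A *v y t)) + G t (y t))) (at t)"
    and p_pos: "p > 0"
    and xi_nonzero: "\<xi> \<noteq> 0"
    and y_asymp: "\<exists>\<epsilon>>0. (\<lambda>t. norm (y t - (t powr (- p)) *\<^sub>R \<xi>)) \<in> O[at_top](\<lambda>t. t powr (- p - \<epsilon>))"
  shows "p = 1 / \<alpha> \<and>
         H \<xi> *\<^sub>R (A *v \<xi>) = (1 / \<alpha>) *\<^sub>R \<xi> \<and>
         eigenvector_of A (1 / (\<alpha> * H \<xi>)) \<xi>"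
proof -
  define z where "z = (\<lambda>t. t powr p *\<^sub>R y t)"
  define w where "w = H \<xi> *\<^sub>R (A *v \<xi>)"
  \<comment> \<open>The map sending x to \<open>H x *\<^sub>R (A *v x)\<close> is homogeneous of
    degree \<open>1 + \<alpha>\<close>, and \<open>y\<close> has size \<open>t powr (- p)\<close>;
    so \<open>t powr q\<close> is the scaling under which this term converges.\<close>
  define q where "q = p * (1 + \<alpha>)"
  define y' where "y' = (\<lambda>t. - (H (y t) *\<^sub>R (A *v y t)) + G t (y t))"
  \<comment> \<open>The product rule for \<open>z\<close>, with the right-hand side of the equation
    in place of the derivative of \<open>y\<close>.\<close>
  define z' where "z' = (\<lambda>t. t powr p *\<^sub>R y' t + (p * t powr (p - 1)) *\<^sub>R y t)"

  have z_lim: "(z \<longlongrightarrow> \<xi>) at_top"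
    unfolding z_def using y_asymp tendsto_rescale_of_bigo by blast
  have y_eq: "y t = t powr (- p) *\<^sub>R z t" if "t > 0" for t
    using that by (simp add: z_def flip: powr_add)

  have H_xi: "H \<xi> > 0"
    using pos_homogeneous_eq_sphere[OF H_hom xi_nonzero] H_pos[of "\<xi> /\<^sub>R norm \<xi>"] xi_nonzero by simp
  have "A *v \<xi> \<noteq> 0"
    using A_pos[of 0] xi_nonzero unfolding eigenvalue_of_def eigenvector_of_def by auto
  with H_xi have "w \<noteq> 0" by (simp add: w_def)

  \<comment> \<open>Limits of the two terms of the equation under rescaling\<close>
  have "isCont H \<xi>"
    using pos_homogeneous_continuous_on[OF H_hom HC_on_imp_continuous_on[OF H_HC]] xi_nonzero
    by (simp add: continuous_on_eq_continuous_at open_Compl)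
  from isCont_tendsto_compose[OF this z_lim]
  have "((\<lambda>t. H (z t) *\<^sub>R (A *v z t)) \<longlongrightarrow> w) at_top"
    unfolding w_def
    by (intro tendsto_scaleR bounded_linear.tendsto[OF matrix_vector_mul_bounded_linear] z_lim)
  moreover have "\<forall>\<^sub>F t in at_top. H (z t) *\<^sub>R (A *v z t) = t powr q *\<^sub>R (H (y t) *\<^sub>R (A *v y t))"
    using eventually_gt_at_top[of 0]
  proof eventually_elim
    case (elim t)
    have "H (z t) = (t powr p) powr \<alpha> * H (y t)"
      using H_hom elim unfolding pos_homogeneous_def z_def by simp
    moreover have "A *v z t = t powr p *\<^sub>R (A *v y t)"
      unfolding z_def by (rule matrix_vector_mult_scaleR)
    moreover have "t powr q = (t powr p) powr \<alpha> * t powr p"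
      by (simp add: q_def powr_powr algebra_simps flip: powr_add)
    ultimately show ?case by (simp add: mult_ac)
  qed
  ultimately have H_lim: "((\<lambda>t. t powr q *\<^sub>R (H (y t) *\<^sub>R (A *v y t))) \<longlongrightarrow> w) at_top"
    by (rule Lim_transform_eventually)

  \<comment> \<open>Since \<open>y\<close> tends to 0, it eventually stays in the ball where the
    bound on \<open>G\<close> applies.\<close>
  have "((\<lambda>t. t powr (- p) *\<^sub>R z t) \<longlongrightarrow> 0 *\<^sub>R \<xi>) at_top"
    using p_pos by (intro tendsto_scaleR z_lim) real_asymp
  then have "((\<lambda>t. norm (t powr (- p) *\<^sub>R z t)) \<longlongrightarrow> 0) at_top"
    by (intro tendsto_norm_zero) simp
  then have small: "\<forall>\<^sub>F t in at_top. norm (t powr (- p) *\<^sub>R z t) < r_star"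
    using \<open>r_star > 0\<close> by (rule order_tendstoD)
  let ?e = "1 + \<alpha> + \<delta>"
  have "\<forall>\<^sub>F t in at_top. norm (t powr q *\<^sub>R G t (y t)) \<le> c_star * t powr (- p * \<delta>) * norm (z t) powr ?e"
    using small eventually_gt_at_top[of 0] eventually_ge_at_top[of T_star]
  proof eventually_elim
    case (elim t)
    have "norm (t powr q *\<^sub>R G t (y t)) = t powr q * norm (G t (y t))" by simp
    also have "\<dots> \<le> t powr q * (c_star * norm (y t) powr ?e)"
      using elim y_eq[of t] by (intro mult_left_mono G_bound) auto
    also have "norm (y t) powr ?e = t powr (- p * ?e) * norm (z t) powr ?e"
      using y_eq[OF elim(2)] by (simp add: powr_mult powr_powr)
    also have "t powr q * (c_star * (t powr (- p * ?e) * norm (z t) powr ?e))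
        = c_star * (t powr q * t powr (- p * ?e)) * norm (z t) powr ?e" by simp
    \<comment> \<open>The degrees \<open>1 + \<alpha>\<close> cancel; the surplus \<delta> leaves a
      decaying power, so \<open>G\<close> is of lower order than the main term.\<close>
    also have "t powr q * t powr (- p * ?e) = t powr (- p * \<delta>)"
      by (simp add: q_def algebra_simps flip: powr_add)
    finally show ?case .
  qed
  moreover have "((\<lambda>t. c_star * t powr (- p * \<delta>) * norm (z t) powr ?e) \<longlongrightarrow> 0 * norm \<xi> powr ?e) at_top"
  proof (intro tendsto_mult tendsto_powr tendsto_norm z_lim tendsto_const)
    have "p * \<delta> > 0" using p_pos \<open>\<delta> > 0\<close> by simp
    then show "((\<lambda>t. c_star * t powr (- p * \<delta>)) \<longlongrightarrow> 0) at_top" by real_asymp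
  \<comment> \<open>\<open>tendsto_powr\<close> asks for a nonzero limit of the base, here
    \<open>norm \<xi>\<close>.\<close>
  qed (use xi_nonzero in simp)
  ultimately have G_lim: "((\<lambda>t. t powr q *\<^sub>R G t (y t)) \<longlongrightarrow> 0) at_top"
    by (simp add: Lim_null_comparison)

  have y'_lim: "((\<lambda>t. t powr q *\<^sub>R y' t) \<longlongrightarrow> - w) at_top"
    using tendsto_add[OF tendsto_minus[OF H_lim] G_lim]
    by (simp only: y'_def scaleR_add_right scaleR_minus_right add_0_right)

  \<comment> \<open>The equation for the rescaled solution\<close>
  have z_deriv: "\<forall>\<^sub>F t in at_top. (z has_vector_derivative z' t) (at t)"
    using eventually_gt_at_top[of 0] eventually_gt_at_top[of T]
  proof eventually_elim
    case (elim t)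
    have "((\<lambda>t. t powr p) has_real_derivative p * t powr (p - 1)) (at t)"
      using elim(1) by (rule has_real_derivative_powr)
    then show ?case
      unfolding z_def z'_def y'_def by (rule has_vector_derivative_scaleR[OF _ y_ode[OF elim(2)]])
  qed
  have tz': "t *\<^sub>R z' t = p *\<^sub>R z t + t powr (1 - p * \<alpha>) *\<^sub>R t powr q *\<^sub>R y' t" if "t > 0" for t
  proof -
    have "t * t powr (p - 1) = t powr p"
      using that powr_add[of t 1 "p - 1"] by simp
    moreover have "t powr (1 - p * \<alpha>) * t powr q = t * t powr p"
      using that powr_add[of t 1 p] by (simp add: q_def algebra_simps flip: powr_add)
    ultimately show ?thesis
      by (simp add: z'_def z_def scaleR_add_right mult.left_commute)
  qed
  \<comment> \<open>One statement serves all three cases: \<open>(s, a, b)\<close> will be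
    \<open>(0, 1, 0)\<close>, \<open>(1 - p * \<alpha>, 0, 1)\<close> and
    \<open>(0, 1, 1)\<close>.\<close>
  have scaled_lim: "((\<lambda>t. t powr (- s) *\<^sub>R t *\<^sub>R z' t) \<longlongrightarrow> a *\<^sub>R p *\<^sub>R \<xi> + b *\<^sub>R (- w)) at_top"
    if "((\<lambda>t. t powr (- s)) \<longlongrightarrow> a) at_top" "((\<lambda>t. t powr (1 - p * \<alpha> - s)) \<longlongrightarrow> b) at_top" for s a b
  proof (rule Lim_transform_eventually)
    show "((\<lambda>t. t powr (- s) *\<^sub>R p *\<^sub>R z t + t powr (1 - p * \<alpha> - s) *\<^sub>R t powr q *\<^sub>R y' t)
        \<longlongrightarrow> a *\<^sub>R p *\<^sub>R \<xi> + b *\<^sub>R (- w)) at_top"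
      by (intro tendsto_intros that z_lim y'_lim)
    show "\<forall>\<^sub>F t in at_top. t powr (- s) *\<^sub>R p *\<^sub>R z t + t powr (1 - p * \<alpha> - s) *\<^sub>R t powr q *\<^sub>R y' t
        = t powr (- s) *\<^sub>R t *\<^sub>R z' t"
      using eventually_gt_at_top[of 0]
    proof eventually_elim
      case (elim t)
      have "t powr (1 - p * \<alpha> - s) = t powr (- s) * t powr (1 - p * \<alpha>)"
        by (simp flip: powr_add)
      then show ?case unfolding tz'[OF elim] by (simp add: scaleR_add_right)
    qed
  qed
  \<comment> \<open>As \<open>0 powr 0 = 0\<close>, the function \<open>t powr 0\<close> is not
    identically 1, so its limit is recorded separately.\<close>
  have one: "((\<lambda>t::real. t powr 0) \<longlongrightarrow> 1) at_top" by real_asymp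

  \<comment> \<open>Comparison of \<open>p * \<alpha>\<close> with 1\<close>
  have "\<not> p * \<alpha> > 1"
  proof
    assume "p * \<alpha> > 1"
    then have "((\<lambda>t::real. t powr (1 - p * \<alpha>)) \<longlongrightarrow> 0) at_top" by real_asymp
    \<comment> \<open>The term from the equation dies out and \<open>t *\<^sub>R z' t\<close> tends
      to \<open>p *\<^sub>R \<xi>\<close>.\<close>
    with convergent_scaled_log_derivative_limit[OF z_lim order_refl z_deriv scaled_lim[of 0 1 0]]
    have "p *\<^sub>R \<xi> = 0" using one by simp
    with p_pos xi_nonzero show False by simp
  qed
  moreover have "\<not> p * \<alpha> < 1"
  proof
    assume less: "p * \<alpha> < 1"
    \<comment> \<open>Here the term from the equation dominates; with
      \<open>s = 1 - p * \<alpha>\<close> it is normalized to the limit \<open>- w\<close>, while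
      the \<open>p *\<^sub>R z t\<close> term vanishes.\<close>
    then have zero: "((\<lambda>t::real. t powr (- (1 - p * \<alpha>))) \<longlongrightarrow> 0) at_top" by real_asymp
    have "((\<lambda>t::real. t powr (1 - p * \<alpha> - (1 - p * \<alpha>))) \<longlongrightarrow> 1) at_top"
      using one by (simp only: diff_self)
    from convergent_scaled_log_derivative_limit[OF z_lim _ z_deriv scaled_lim[OF zero this]]
    have "0 *\<^sub>R p *\<^sub>R \<xi> + 1 *\<^sub>R (- w) = 0" using less by simp
    with \<open>w \<noteq> 0\<close> show False by simp
  qed
  ultimately have p_alpha: "p * \<alpha> = 1" by simp
  then have p_eq: "p = 1 / \<alpha>" using alpha_pos by (simp add: field_simps)
  \<comment> \<open>In the balanced case both terms survive in the limit without any weight.\<close>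
  have "p *\<^sub>R \<xi> - w = 0"
    using convergent_scaled_log_derivative_limit[OF z_lim order_refl z_deriv scaled_lim[of 0 1 1]]
      one p_alpha by simp
  then have w_eq: "H \<xi> *\<^sub>R (A *v \<xi>) = (1 / \<alpha>) *\<^sub>R \<xi>" by (simp add: w_def p_eq)
  have "A *v \<xi> = (1 / H \<xi>) *\<^sub>R (H \<xi> *\<^sub>R (A *v \<xi>))" using H_xi by simp
  also have "\<dots> = (1 / (\<alpha> * H \<xi>)) *\<^sub>R \<xi>" unfolding w_eq by simp
  finally have "eigenvector_of A (1 / (\<alpha> * H \<xi>)) \<xi>"
    using xi_nonzero by (simp only: eigenvector_of_def simp_thms)
  with p_eq w_eq show ?thesis by (intro conjI)
qed

end
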